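(* Let $r, b$ be any non-negative integers. There exist a topological space $X$ and a continuous function $f : X \to \mathbb{R}$ such that the cycle rank of the Reeb graph $R_f$ and the first Betti number of $X$ satisfy $$b_1(R_f) = r, \qquad b_1(X) = b.$$
   Context: A contour of $f : X \to \mathbb{R}$ is a connected component of a level set $f^{-1}(y)$, $y \in \mathbb{R}$. The Reeb graph $R_f$ of $f$ is the quotient space $X/\sim$ with the quotient topology, where $x \sim y$ iff $x$ and $y$ lie in the same contour of $f$. The first Betti number $b_1$ is the rank of the first singular homology group; the cycle rank of $R_f$ is $b_1(R_f)$. *)

theory Defs
  imports "HOL-Analysis.Analysis" "HOL-Homology.Homology" "HOL-Library.Extended_Nat"
begin

definition contours :: "'a topology \<Rightarrow> ('a \<Rightarrow> real) \<Rightarrow> 'a set set" where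
  "contours X f =
     (\<Union>y. connected_components_of (subtopology X {x \<in> topspace X. f x = y}))"

definition contour_rel :: "'a topology \<Rightarrow> ('a \<Rightarrow> real) \<Rightarrow> ('a \<times> 'a) set" where
  "contour_rel X f = {(x, x'). \<exists>C \<in> contours X f. x \<in> C \<and> x' \<in> C}"

text \<open>The quotient of \<open>X\<close> by an equivalence relation \<open>R\<close> on \<open>topspace X\<close>. The points are the
  equivalence classes, so the preimage of a set \<open>U\<close> of classes under the projection is \<open>\<Union>U\<close>.\<close>

definition quotient_space :: "'a topology \<Rightarrow> ('a \<times> 'a) set \<Rightarrow> 'a set topology" where
  "quotient_space X R = topology (\<lambda>U. U \<subseteq> topspace X // R \<and> openin X (\<Union>U))"

definition reeb_graph :: "'a topology \<Rightarrow> ('a \<Rightarrow> real) \<Rightarrow> 'a set topology" where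
  "reeb_graph X f = quotient_space X (contour_rel X f)"

definition int_independent :: "('a, 'b) monoid_scheme \<Rightarrow> 'a set \<Rightarrow> bool" where
  "int_independent G S \<longleftrightarrow>
     finite S \<and> S \<subseteq> carrier G \<and>
     (\<forall>c :: 'a \<Rightarrow> int.
        finprod G (\<lambda>x. x [^]\<^bsub>G\<^esub> c x) S = \<one>\<^bsub>G\<^esub> \<longrightarrow> (\<forall>x\<in>S. c x = 0))"

text \<open>The rank of a (multiplicatively written) abelian group; it takes the value \<open>\<infinity>\<close> if there are
  arbitrarily large finite independent sets.\<close>

definition abelian_rank :: "('a, 'b) monoid_scheme \<Rightarrow> enat" where
  "abelian_rank G = (SUP S \<in> {S. int_independent G S}. enat (card S))"

definition betti_number :: "nat \<Rightarrow> 'a topology \<Rightarrow> enat" where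
  "betti_number p X = abelian_rank (homology_group (int p) X)"

definition cycle_rank :: "'a topology \<Rightarrow> enat" where
  "cycle_rank X = betti_number 1 X"


lemma quotient_Union_Int:
  assumes "equiv A R" "U \<subseteq> A // R" "V \<subseteq> A // R"
  shows "\<Union>(U \<inter> V) = \<Union>U \<inter> \<Union>V"
proof
  show "\<Union>U \<inter> \<Union>V \<subseteq> \<Union>(U \<inter> V)"
  proof
    fix x assume "x \<in> \<Union>U \<inter> \<Union>V"
    then obtain C D where CD: "C \<in> U" "D \<in> V" "x \<in> C" "x \<in> D" by blast
    then have "C = D"
      using quotient_disj[OF assms(1), of C D] assms(2,3) by blast
    then show "x \<in> \<Union>(U \<inter> V)" using CD by blast
  qed
qed blast

lemma openin_quotient_space:
  assumes "equiv (topspace X) R"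
  shows "openin (quotient_space X R) U \<longleftrightarrow> U \<subseteq> topspace X // R \<and> openin X (\<Union>U)"
proof -
  have "istopology (\<lambda>U. U \<subseteq> topspace X // R \<and> openin X (\<Union>U))"
    unfolding istopology_def
  proof (intro conjI allI impI)
    fix \<K> :: "'a set set set"
    assume K: "\<forall>K\<in>\<K>. K \<subseteq> topspace X // R \<and> openin X (\<Union>K)"
    then show "\<Union>\<K> \<subseteq> topspace X // R" by blast
    have "\<Union>(\<Union>\<K>) = (\<Union>K\<in>\<K>. \<Union>K)" by blast
    then show "openin X (\<Union>(\<Union>\<K>))" using K by auto
  qed (use assms in \<open>auto simp: quotient_Union_Int\<close>)
  then show ?thesis
    by (simp add: quotient_space_def)
qed

lemma topspace_quotient_space:
  assumes "equiv (topspace X) R"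
  shows "topspace (quotient_space X R) = topspace X // R"
proof -
  have "openin (quotient_space X R) (topspace X // R)"
    by (simp add: openin_quotient_space[OF assms] Union_quotient[OF assms])
  then show ?thesis
    using openin_subset openin_quotient_space[OF assms] openin_topspace by blast
qed

lemma quotient_map_quotient_space:
  assumes "equiv (topspace X) R"
  shows "quotient_map X (quotient_space X R) (\<lambda>x. R `` {x})"
proof -
  have "{x \<in> topspace X. R `` {x} \<in> U} = \<Union>U" if "U \<subseteq> topspace X // R" for U
  proof
    show "{x \<in> topspace X. R `` {x} \<in> U} \<subseteq> \<Union>U"
      using equiv_class_self[OF assms] by blast
    show "\<Union>U \<subseteq> {x \<in> topspace X. R `` {x} \<in> U}"
    proof
      fix x assume "x \<in> \<Union>U"
      then obtain C where C: "C \<in> U" "x \<in> C" by blast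
      then obtain a where a: "a \<in> topspace X" "C = R `` {a}"
        using \<open>U \<subseteq> topspace X // R\<close> by (blast elim: quotientE)
      then have "(a, x) \<in> R" using C by simp
      then have "R `` {a} = R `` {x}" "x \<in> topspace X"
        using equiv_class_eq_iff[OF assms, of a x] by simp_all
      with a C show "x \<in> {x \<in> topspace X. R `` {x} \<in> U}" by simp
    qed
  qed
  then show ?thesis
    unfolding quotient_map_def
    by (auto simp: topspace_quotient_space[OF assms] openin_quotient_space[OF assms] quotient_def)
qed

lemma mem_contours_iff:
  "C \<in> contours X f \<longleftrightarrow>
     (\<exists>y. C \<in> connected_components_of (subtopology X {x \<in> topspace X. f x = y}))"
  by (simp add: contours_def)

lemma contours_disjoint:
  assumes "C \<in> contours X f" "D \<in> contours X f" "x \<in> C" "x \<in> D"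
  shows "C = D"
proof -
  obtain y z where
    C: "C \<in> connected_components_of (subtopology X {x \<in> topspace X. f x = y})" and
    D: "D \<in> connected_components_of (subtopology X {x \<in> topspace X. f x = z})"
    using assms by (auto simp: mem_contours_iff)
  have "y = z"
    using connected_components_of_subset[OF C] connected_components_of_subset[OF D] assms
    by auto
  then show ?thesis
    using C D assms(3,4) connected_components_of_disjoint[of C _ D] by (auto simp: disjnt_iff)
qed

lemma Union_contours: "\<Union>(contours X f) = topspace X"
proof -
  have "\<Union>(contours X f) =
      (\<Union>y. \<Union>(connected_components_of (subtopology X {x \<in> topspace X. f x = y})))"
    unfolding contours_def by blast
  then show ?thesis
    by (auto simp: Union_connected_components_of)
qed

lemma equiv_contour_rel: "equiv (topspace X) (contour_rel X f)"
proof (rule equivI)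
  show "contour_rel X f \<subseteq> topspace X \<times> topspace X" "refl_on (topspace X) (contour_rel X f)"
    using Union_contours[of X f] by (auto simp: refl_on_def contour_rel_def)
  show "sym (contour_rel X f)"
    by (auto simp: sym_def contour_rel_def)
  show "trans (contour_rel X f)"
    unfolding trans_def contour_rel_def by (blast dest: contours_disjoint)
qed

lemma quotient_contour_rel: "topspace X // contour_rel X f = contours X f"
proof -
  have *: "contour_rel X f `` {x} = C" if "C \<in> contours X f" "x \<in> C" for x C
    using that contours_disjoint by (fastforce simp: contour_rel_def)
  have "C \<noteq> {}" if "C \<in> contours X f" for C
    using that nonempty_connected_components_of by (auto simp: mem_contours_iff)
  note nonempty = this
  show ?thesis
  proof
    show "topspace X // contour_rel X f \<subseteq> contours X f"
    proof
      fix A assume "A \<in> topspace X // contour_rel X f"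
      then obtain x where x: "x \<in> topspace X" "A = contour_rel X f `` {x}"
        by (rule quotientE)
      then obtain C where "C \<in> contours X f" "x \<in> C"
        using Union_contours[of X f] by blast
      then show "A \<in> contours X f" using * x by simp
    qed
    show "contours X f \<subseteq> topspace X // contour_rel X f"
    proof
      fix C assume C: "C \<in> contours X f"
      then obtain x where x: "x \<in> C" using nonempty by blast
      then have "x \<in> topspace X" using C Union_contours[of X f] by blast
      then show "C \<in> topspace X // contour_rel X f"
        using quotientI[of x "topspace X" "contour_rel X f"] *[OF C x] by simp
    qed
  qed
qed

lemma topspace_reeb_graph: "topspace (reeb_graph X f) = contours X f"
  by (simp add: reeb_graph_def topspace_quotient_space equiv_contour_rel quotient_contour_rel)

lemma quotient_map_reeb_graph:
  "quotient_map X (reeb_graph X f) (\<lambda>x. contour_rel X f `` {x})"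
  by (simp add: reeb_graph_def quotient_map_quotient_space equiv_contour_rel)

end

theory Submission
  imports Defs
begin

text \<open>Contours need only be connected, not path-connected, so passing to the Reeb graph can create
  cycles. Give \<open>S \<times> \<real>\<close>, with \<open>S\<close> a circle, the topology generated by the sets \<open>V \<times> \<real> - C\<close> with \<open>V\<close> open
  and \<open>C\<close> countable. All countable sets are closed, so compact sets are finite and paths are constant:
  the first homology vanishes. The fibres \<open>{y} \<times> \<real>\<close> carry the cocountable topology and are
  connected, and the projection to \<open>S\<close> is a quotient map; hence a function on \<open>S\<close> with finite level
  sets, pulled back to \<open>S \<times> \<real>\<close>, has \<open>S\<close> itself as its Reeb graph. An ordinary circle with a constant
  function shows the opposite behaviour. Take the disjoint sum of \<open>r\<close> spaces of the first and \<open>b\<close>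
  of the second kind. The rank of a finite direct sum of copies of \<open>\<int>\<close> is computed by linear
  algebra.\<close>

section \<open>Rank of a finite direct sum of copies of the integers\<close>

text \<open>Gaussian elimination without division keeps the coefficients integral. The induction
  removes one coordinate at a time; \<open>S\<close> and \<open>v\<close> are generalized because
  elimination drops the pivot vector and changes the others.\<close>

lemma int_vectors_dependent:
  fixes v :: "'a \<Rightarrow> 'b \<Rightarrow> int"
  assumes "finite J" "finite S" "card J < card S"
  shows "\<exists>c. (\<exists>x\<in>S. c x \<noteq> 0) \<and> (\<forall>j\<in>J. (\<Sum>x\<in>S. c x * v x j) = 0)"
  using assms
proof (induction J arbitrary: S v rule: finite_induct)
  case empty
  then have "S \<noteq> {}" by auto
  then show ?case by (auto intro!: exI[of _ "\<lambda>_. 1"])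
next
  case (insert j J)
  show ?case
  proof (cases "\<forall>x\<in>S. v x j = 0")
    case True
    have "card J < card S" using insert by simp
    with insert.IH[OF insert.prems(1), of v] True show ?thesis by auto
  next
    case False
    then obtain a where a: "a \<in> S" "v a j \<noteq> 0" by blast
    define S' where "S' = S - {a}"
    have S': "finite S'" "a \<notin> S'" "S = insert a S'"
      using a insert.prems by (auto simp: S'_def)
    then have "card J < card S'" using insert by simp
    \<comment> \<open>fraction-free elimination of the \<open>j\<close>-th entry with pivot \<open>v a j\<close>\<close>
    from insert.IH[OF S'(1) this, of "\<lambda>x i. v a j * v x i - v x j * v a i"]
    obtain c where c: "\<exists>x\<in>S'. c x \<noteq> 0"
      "\<And>i. i \<in> J \<Longrightarrow> (\<Sum>x\<in>S'. c x * (v a j * v x i - v x j * v a i)) = 0" by blast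
    \<comment> \<open>A relation between the reduced vectors becomes one between the original
      vectors: the old coefficients are scaled by the pivot entry, and \<open>a\<close> receives all
      the subtracted multiples. As the pivot entry is nonzero, a nonzero coefficient stays
      nonzero.\<close>
    define c' where "c' x = (if x = a then - (\<Sum>x\<in>S'. c x * v x j) else c x * v a j)" for x
    have sum_c': "(\<Sum>x\<in>S. c' x * v x i) = (\<Sum>x\<in>S'. c x * (v a j * v x i - v x j * v a i))" for i
    proof -
      have "(\<Sum>x\<in>S'. c' x * v x i) = (\<Sum>x\<in>S'. c x * v a j * v x i)"
        using S' by (intro sum.cong) (auto simp: c'_def)
      then show ?thesis
        using S' by (simp add: c'_def sum_subtractf sum_distrib_left sum_distrib_right algebra_simps)
    qed
    have "\<exists>x\<in>S. c' x \<noteq> 0" using c(1) a S' by (auto simp: c'_def)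
    \<comment> \<open>For \<open>i = j\<close> each summand on the right of \<open>sum_c'\<close>
      vanishes identically, by the choice of the reduced vectors.\<close>
    moreover have "\<forall>i\<in>insert j J. (\<Sum>x\<in>S. c' x * v x i) = 0"
      unfolding sum_c' using c(2) by auto
    ultimately show ?thesis by blast
  qed
qed

lemma hom_integer_group_finprod:
  fixes G (structure)
  assumes "comm_group G" "h \<in> hom G integer_group" "finite S" "S \<subseteq> carrier G"
  shows "h (finprod G (\<lambda>x. x [^] (c x :: int)) S) = (\<Sum>x\<in>S. c x * h x)"
  using assms(3,4)
proof (induction S rule: finite_induct)
  interpret comm_group G by fact
  interpret h: group_hom G integer_group h
    using assms(2) by (simp add: group_hom_def group_hom_axioms_def is_group)
  case empty
  then show ?case using h.hom_one by simp
next
  interpret comm_group G by fact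
  interpret h: group_hom G integer_group h
    using assms(2) by (simp add: group_hom_def group_hom_axioms_def is_group)
  case (insert x S)
  then have "finprod G (\<lambda>x. x [^] c x) (insert x S) = x [^] c x \<otimes> finprod G (\<lambda>x. x [^] c x) S"
    by (intro finprod_insert) auto
  moreover have "finprod G (\<lambda>x. x [^] c x) S \<in> carrier G"
    using insert.prems by (intro finprod_closed) auto
  ultimately show ?case
    using insert h.hom_int_pow[of x "c x"] by simp
qed

text \<open>The \<open>\<phi> j\<close> serve as coordinates. Being jointly injective, they turn any
  integer relation between coordinate vectors into a relation in \<open>G\<close>, which bounds the
  rank from above. The elements \<open>e j\<close> form a dual system: \<open>\<phi> j\<close> reads
  off the coefficient of \<open>e j\<close>, so they are independent.\<close>

lemma abelian_rank_eq_card: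
  fixes G (structure)
  assumes G: "comm_group G" and J: "finite J"
    and \<phi>: "\<And>j. j \<in> J \<Longrightarrow> \<phi> j \<in> hom G integer_group"
    and faithful: "\<And>x. x \<in> carrier G \<Longrightarrow> (\<And>j. j \<in> J \<Longrightarrow> \<phi> j x = 0) \<Longrightarrow> x = \<one>\<^bsub>G\<^esub>"
    and e: "\<And>j. j \<in> J \<Longrightarrow> e j \<in> carrier G"
    and dual: "\<And>i j. i \<in> J \<Longrightarrow> j \<in> J \<Longrightarrow> \<phi> i (e j) = (if i = j then 1 else 0)"
  shows "abelian_rank G = enat (card J)"
  unfolding abelian_rank_def
proof (rule antisym)
  interpret comm_group G by fact
  note sum = hom_integer_group_finprod[OF G \<phi>]
  show "(SUP S\<in>{S. int_independent G S}. enat (card S)) \<le> enat (card J)"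
  proof (rule SUP_least)
    fix S assume "S \<in> {S. int_independent G S}"
    then have S: "finite S" "S \<subseteq> carrier G"
      and indep: "\<And>c :: _ \<Rightarrow> int. finprod G (\<lambda>x. x [^] c x) S = \<one> \<Longrightarrow> \<forall>x\<in>S. c x = 0"
      by (auto simp: int_independent_def)
    have "card S \<le> card J"
    proof (rule ccontr)
      assume "\<not> card S \<le> card J"
      then obtain c where c: "\<exists>x\<in>S. c x \<noteq> 0" "\<forall>j\<in>J. (\<Sum>x\<in>S. c x * \<phi> j x) = 0"
        using int_vectors_dependent[OF J S(1), of "\<lambda>x j. \<phi> j x"] by auto
      have "finprod G (\<lambda>x. x [^] c x) S = \<one>"
      proof (rule faithful)
        show "finprod G (\<lambda>x. x [^] c x) S \<in> carrier G"
          using S by (intro finprod_closed) auto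
      qed (use sum S c in auto)
      with indep c(1) show False by blast
    qed
    then show "enat (card S) \<le> enat (card J)" by simp
  qed
  \<comment> \<open>Coefficients in \<open>int_independent\<close> are indexed by group elements.
    Injectivity turns sums over the image of \<open>J\<close> into sums over \<open>J\<close> and
    gives the image the cardinality of \<open>J\<close>.\<close>
  have inj: "inj_on e J"
    by (rule inj_onI) (metis dual zero_neq_one)
  have "int_independent G (e ` J)"
    unfolding int_independent_def
  proof (intro conjI allI impI ballI)
    fix c :: "_ \<Rightarrow> int" and x
    assume eq: "finprod G (\<lambda>x. x [^] c x) (e ` J) = \<one>" and "x \<in> e ` J"
    then obtain j where j: "j \<in> J" "x = e j" by blast
    interpret h: group_hom G integer_group "\<phi> j"
      using \<phi>[OF j(1)] by (simp add: group_hom_def group_hom_axioms_def is_group)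
    have "0 = \<phi> j (finprod G (\<lambda>x. x [^] c x) (e ` J))"
      using eq h.hom_one by simp
    also have "\<dots> = (\<Sum>x\<in>e ` J. c x * \<phi> j x)"
      using sum[OF j(1), of "e ` J"] J e by auto
    also have "\<dots> = (\<Sum>i\<in>J. if j = i then c (e i) else 0)"
      unfolding sum.reindex[OF inj] o_def using dual[OF j(1)] by (intro sum.cong) auto
    finally show "c x = 0" using J j by simp
  qed (use J e in auto)
  then have "enat (card (e ` J)) \<le> (SUP S\<in>{S. int_independent G S}. enat (card S))"
    by (intro SUP_upper) simp
  then show "enat (card J) \<le> (SUP S\<in>{S. int_independent G S}. enat (card S))"
    by (simp add: card_image inj)
qed

text \<open>Each infinite cyclic factor supplies one coordinate: apply the isomorphism to the sum,
  project to the factor, and identify the factor with the integers. The remaining factors are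
  trivial, so these coordinates determine an element.\<close>

lemma abelian_rank_sum_group:
  assumes G: "comm_group G" "G \<cong> sum_group I A" and I: "finite I"
    and A: "\<And>i. i \<in> I \<Longrightarrow> group (A i)"
    and A_cases: "\<And>i. i \<in> I \<Longrightarrow> A i \<cong> integer_group \<or> trivial_group (A i)"
  shows "abelian_rank G = enat (card {i \<in> I. A i \<cong> integer_group})"
proof -
  obtain h where h: "h \<in> iso G (sum_group I A)" using G(2) by (auto simp: is_iso_def)
  define J where "J = {i \<in> I. A i \<cong> integer_group}"
  obtain k where k: "\<And>j. j \<in> J \<Longrightarrow> k j \<in> iso (A j) integer_group"
  proof -
    have "\<forall>j\<in>J. \<exists>k. k \<in> iso (A j) integer_group" by (auto simp: J_def is_iso_def)
    then show thesis using that by (metis (no_types))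
  qed
  have carrier: "carrier (sum_group I A) = (\<Pi>\<^sub>E i\<in>I. carrier (A i))"
    using A I by (auto simp: carrier_sum_group)
  interpret G: comm_group G by fact
  interpret S: group "sum_group I A" using A by simp
  interpret h: group_hom G "sum_group I A" h
    using h by (simp add: group_hom_def group_hom_axioms_def iso_def G.is_group S.is_group)
  have h_img: "h ` carrier G = carrier (sum_group I A)" and h_inj: "inj_on h (carrier G)"
    using h by (auto simp: iso_def bij_betw_def)
  define u where "u j = inv_into (carrier (A j)) (k j) 1" for j
  have u: "u j \<in> carrier (A j)" "k j (u j) = 1" if "j \<in> J" for j
  proof -
    have "1 \<in> k j ` carrier (A j)" using k[OF that] by (auto simp: iso_def bij_betw_def)
    then show "u j \<in> carrier (A j)" "k j (u j) = 1"
      unfolding u_def by (auto intro: inv_into_into f_inv_into_f)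
  qed
  have k_one: "k j \<one>\<^bsub>A j\<^esub> = 0" if "j \<in> J" for j
  proof -
    have "group_hom (A j) integer_group (k j)"
      using k[OF that] A that
      by (auto simp: group_hom_def group_hom_axioms_def iso_def J_def)
    from group_hom.hom_one[OF this] show ?thesis by simp
  qed
  \<comment> \<open>The dual system: \<open>t j\<close> has the generator \<open>u j\<close> of its
    factor at \<open>j\<close> and units elsewhere, and \<open>e j\<close> is its preimage in
    \<open>G\<close>.\<close>
  define t where "t j = (\<lambda>i\<in>I. if i = j then u j else \<one>\<^bsub>A i\<^esub>)" for j
  define e where "e j = inv_into (carrier G) h (t j)" for j
  have t: "t j \<in> carrier (sum_group I A)" if "j \<in> J" for j
    using u that A by (auto simp: carrier t_def group.is_monoid)
  have e: "e j \<in> carrier G" "h (e j) = t j" if "j \<in> J" for j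
    using t[OF that] h_img unfolding e_def by (metis inv_into_into, metis f_inv_into_f)
  show ?thesis unfolding J_def[symmetric]
  proof (rule abelian_rank_eq_card[OF G(1), where \<phi> = "\<lambda>j x. k j (h x j)" and e = e])
    show "finite J" using I by (simp add: J_def)
    show "(\<lambda>x. k j (h x j)) \<in> hom G integer_group" if "j \<in> J" for j
    proof (rule homI)
      fix x y assume "x \<in> carrier G" "y \<in> carrier G"
      moreover from this have "h x j \<in> carrier (A j)" "h y j \<in> carrier (A j)"
        using that h.hom_closed unfolding carrier J_def by auto
      ultimately show "k j (h (x \<otimes>\<^bsub>G\<^esub> y) j) = k j (h x j) \<otimes>\<^bsub>integer_group\<^esub> k j (h y j)"
        using that k[OF that] by (simp add: iso_def hom_def J_def)
    qed simp
    show "x = \<one>\<^bsub>G\<^esub>" if x: "x \<in> carrier G" and 0: "\<And>j. j \<in> J \<Longrightarrow> k j (h x j) = 0" for x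
    proof -
      have hx: "h x \<in> (\<Pi>\<^sub>E i\<in>I. carrier (A i))" using h.hom_closed[OF x] by (simp add: carrier)
      have "h x i = \<one>\<^bsub>A i\<^esub>" if i: "i \<in> I" for i
      proof (cases "i \<in> J")
        case True
        then have "inj_on (k i) (carrier (A i))" using k by (auto simp: iso_def bij_betw_def)
        moreover have "k i (h x i) = k i \<one>\<^bsub>A i\<^esub>" using 0 k_one True by simp
        moreover have "h x i \<in> carrier (A i)" "\<one>\<^bsub>A i\<^esub> \<in> carrier (A i)"
          using hx i A by (auto simp: group.is_monoid monoid.one_closed)
        ultimately show ?thesis by (rule inj_onD)
      next
        case False
        then have "trivial_group (A i)" using A_cases i by (auto simp: J_def)
        then show ?thesis using hx i by (auto simp: trivial_group_def)
      qed
      then have "h x = \<one>\<^bsub>sum_group I A\<^esub>"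
        using hx by (auto simp: PiE_def extensional_def fun_eq_iff)
      then show ?thesis using h_inj x h.hom_one by (metis G.one_closed inj_onD)
    qed
    show "k i (h (e j) i) = (if i = j then 1 else 0)" if "i \<in> J" "j \<in> J" for i j
      using that u k_one e by (auto simp: t_def J_def)
  qed (rule e)
qed

section \<open>Vanishing homology when countable sets are closed\<close>

lemma trivial_sum_group:
  assumes "\<And>i. i \<in> I \<Longrightarrow> trivial_group (A i)"
  shows "trivial_group (sum_group I A)"
proof -
  have A: "group (A i)" "carrier (A i) = {\<one>\<^bsub>A i\<^esub>}" if "i \<in> I" for i
    using assms[OF that] by (auto simp: trivial_group_def)
  have "carrier (sum_group I A) \<subseteq> {\<one>\<^bsub>sum_group I A\<^esub>}"
    using A by (auto simp: carrier_sum_group PiE_iff extensional_def fun_eq_iff)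
  moreover have gp: "group (sum_group I A)"
    using A(1) by (rule sum_group)
  ultimately show ?thesis
    using monoid.one_closed[OF group.is_monoid[OF gp]] gp
    unfolding trivial_group_def by (intro conjI subset_antisym) auto
qed

text \<open>For a countably infinite \<open>D\<close> inside \<open>K\<close>, the open sets
  \<open>U d\<close> cover \<open>K\<close>, but each contains only the point \<open>d\<close> of
  \<open>D\<close>. A finite subcover would therefore leave some point of \<open>D\<close>
  uncovered.\<close>

lemma compactin_imp_finite_if_countable_closed:
  assumes closed: "\<And>C. countable C \<Longrightarrow> C \<subseteq> topspace X \<Longrightarrow> closedin X C"
    and K: "compactin X K"
  shows "finite K"
proof (rule ccontr)
  assume "infinite K"
  then obtain D where D: "D \<subseteq> K" "infinite D" "countable D"
    using infinite_countable_subset' by blast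
  have KX: "K \<subseteq> topspace X" using K by (rule compactin_subset_topspace)
  define U where "U d = topspace X - (D - {d})" for d
  have "openin X (U d)" for d
    unfolding U_def using closed[of "D - {d}"] D KX by auto
  moreover have "K \<subseteq> \<Union>(U ` D)"
    using D KX by (fastforce simp: U_def)
  ultimately obtain \<F> where "finite \<F>" "\<F> \<subseteq> U ` D" "K \<subseteq> \<Union>\<F>"
    using K unfolding compactin_def by (metis (no_types, lifting) imageE)
  then obtain F where "finite F" "F \<subseteq> D" "K \<subseteq> \<Union>(U ` F)"
    by (metis finite_subset_image)
  then have "D \<subseteq> F" using D by (fastforce simp: U_def)
  with \<open>finite F\<close> D show False using finite_subset by blast
qed

text \<open>Finite subspaces of a T1 space are discrete. This serves twice: for compact
  path-connected sets, and for images of contours in finite level sets.\<close>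

lemma t1_space_finite_connectedin:
  assumes "t1_space X" "finite C" "connectedin X C" "x \<in> C" "y \<in> C"
  shows "x = y"
proof -
  have "C \<subseteq> topspace X" using assms connectedin_subset_topspace by blast
  then have "subtopology X C = discrete_topology C"
    using assms by (simp add: subtopology_eq_discrete_topology_finite)
  then have "connected_space (discrete_topology C)"
    using assms by (simp add: connectedin_def)
  then show ?thesis
    using assms by (auto simp: connected_space_discrete_topology)
qed

text \<open>Singular homology only sees compact path-connected sets, and here these are finite and
  connected in a T1 space, hence at most points. The general additivity axiom thus applies to the
  partition into singletons, and the dimension axiom kills every summand.\<close>

lemma trivial_homology_group_countable_closed:
  assumes closed: "\<And>C. countable C \<Longrightarrow> C \<subseteq> topspace X \<Longrightarrow> closedin X C" and "p \<noteq> 0"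
  shows "trivial_group (homology_group p X)"
proof -
  have t1: "t1_space X"
    by (simp add: t1_space_closedin_singleton closed)
  define \<U> where "\<U> = (\<lambda>x. {x}) ` topspace X"
  have "sum_group \<U> (\<lambda>S. homology_group p (subtopology X S)) \<cong> homology_group p X"
  proof (rule is_isoI[OF homology_additivity_axiom_gen])
    show "pairwise disjnt \<U>" "\<Union>\<U> = topspace X"
      by (auto simp: \<U>_def pairwise_def)
    fix C T assume C: "compactin X C" "path_connectedin X C" and "T \<in> \<U>" "\<not> disjnt C T"
    then obtain x where "T = {x}" "x \<in> C" by (auto simp: \<U>_def)
    moreover have "finite C" using compactin_imp_finite_if_countable_closed closed C(1) by blast
    ultimately show "C \<subseteq> T"
      using t1_space_finite_connectedin[OF t1 _ path_connectedin_imp_connectedin[OF C(2)]] by auto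
  qed
  moreover have "trivial_group (sum_group \<U> (\<lambda>S. homology_group p (subtopology X S)))"
    by (rule trivial_sum_group) (auto simp: \<U>_def intro!: homology_dimension_axiom \<open>p \<noteq> 0\<close>)
  ultimately show ?thesis
    by (simp add: isomorphic_group_triviality1)
qed

section \<open>The product with fibres carrying the cocountable topology\<close>

text \<open>This is the join of two topologies: the product of \<open>Y\<close> with an indiscrete
  real line, and the cocountable topology on the whole product. Since \<open>z\<close> is taken from
  \<open>W\<close>, the exceptional set \<open>C\<close> may contain \<open>z\<close>.\<close>

definition countably_fine_product :: "'a topology \<Rightarrow> ('a \<times> real) topology" where
  "countably_fine_product Y = topology (\<lambda>W. W \<subseteq> topspace Y \<times> UNIV \<and>
     (\<forall>z\<in>W. \<exists>V C. openin Y V \<and> fst z \<in> V \<and> countable C \<and> V \<times> UNIV - C \<subseteq> W))"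

text \<open>The neighbourhood condition \<open>N\<close> is monotone in \<open>W\<close>, and it is
  stable under intersection because a union of two countable sets is countable. This makes the
  defining predicate a topology.\<close>

lemma openin_countably_fine_product:
  "openin (countably_fine_product Y) W \<longleftrightarrow> W \<subseteq> topspace Y \<times> UNIV \<and>
     (\<forall>z\<in>W. \<exists>V C. openin Y V \<and> fst z \<in> V \<and> countable C \<and> V \<times> UNIV - C \<subseteq> W)"
proof -
  define N where "N z W \<longleftrightarrow>
    (\<exists>V C. openin Y V \<and> fst z \<in> V \<and> countable C \<and> V \<times> UNIV - C \<subseteq> W)"
    for z :: "'a \<times> real" and W :: "('a \<times> real) set"
  have N_Int: "N z (W \<inter> W')" if N: "N z W" "N z W'" for z W W'
  proof -
    obtain V C where V: "openin Y V" "fst z \<in> V" "countable C" "V \<times> UNIV - C \<subseteq> W"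
      using N(1) unfolding N_def by metis
    obtain V' C' where V': "openin Y V'" "fst z \<in> V'" "countable C'" "V' \<times> UNIV - C' \<subseteq> W'"
      using N(2) unfolding N_def by metis
    have "openin Y (V \<inter> V')" "fst z \<in> V \<inter> V'" "countable (C \<union> C')"
      using V(1-3) V'(1-3) by auto
    moreover have "(V \<inter> V') \<times> UNIV - (C \<union> C') \<subseteq> W \<inter> W'"
      using V(4) V'(4) by blast
    ultimately show ?thesis unfolding N_def by (intro exI conjI)
  qed
  have N_mono: "N z W'" if "N z W" "W \<subseteq> W'" for z W W'
    using that unfolding N_def by (meson order_trans)
  have "istopology (\<lambda>W. W \<subseteq> topspace Y \<times> (UNIV :: real set) \<and> (\<forall>z\<in>W. N z W))"
    unfolding istopology_def
  proof (intro conjI allI impI)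
    fix \<K> assume K: "\<forall>K\<in>\<K>. K \<subseteq> topspace Y \<times> (UNIV :: real set) \<and> (\<forall>z\<in>K. N z K)"
    then show "\<Union>\<K> \<subseteq> topspace Y \<times> UNIV" by blast
    show "\<forall>z\<in>\<Union>\<K>. N z (\<Union>\<K>)" using K N_mono by (meson UnionE Union_upper)
  qed (use N_Int in blast)+
  then show ?thesis
    by (simp add: countably_fine_product_def N_def)
qed

lemma openin_Times_countably_fine_product:
  assumes "openin Y V"
  shows "openin (countably_fine_product Y) (V \<times> UNIV)"
proof -
  have "openin Y V \<and> fst z \<in> V \<and> countable {} \<and> V \<times> UNIV - {} \<subseteq> V \<times> (UNIV :: real set)"
    if "z \<in> V \<times> UNIV" for z :: "'a \<times> real"
    using that assms by auto
  then show ?thesis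
    unfolding openin_countably_fine_product using openin_subset[OF assms] by blast
qed

lemma topspace_countably_fine_product [simp]:
  "topspace (countably_fine_product Y) = topspace Y \<times> UNIV"
proof
  show "topspace (countably_fine_product Y) \<subseteq> topspace Y \<times> UNIV"
    using openin_topspace[of "countably_fine_product Y"]
    unfolding openin_countably_fine_product by blast
  show "topspace Y \<times> UNIV \<subseteq> topspace (countably_fine_product Y)"
    by (intro openin_subset openin_Times_countably_fine_product) simp
qed

lemma closedin_countable_countably_fine_product:
  assumes "countable C" "C \<subseteq> topspace (countably_fine_product Y)"
  shows "closedin (countably_fine_product Y) C"
proof -
  have "openin Y (topspace Y) \<and> fst z \<in> topspace Y \<and> countable C
      \<and> topspace Y \<times> UNIV - C \<subseteq> topspace Y \<times> UNIV - C"
    if "z \<in> topspace Y \<times> UNIV - C" for z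
    using that assms by auto
  then show ?thesis
    unfolding closedin_def openin_countably_fine_product topspace_countably_fine_product
    using assms by (intro conjI ballI) (simp, blast, blast)
qed

lemma uncountable_fibre_minus_countable:
  assumes "countable C"
  shows "\<exists>s :: real. (y, s) \<notin> C"
proof (rule ccontr)
  assume "\<nexists>s :: real. (y, s) \<notin> C"
  then have "UNIV \<subseteq> snd ` C" by force
  then show False
    using assms uncountable_UNIV_real by (metis countable_image countable_subset)
qed

text \<open>Removing countably many points from \<open>V \<times> UNIV\<close> never removes a whole
  fibre, so the remainder still projects onto \<open>V\<close>. Hence openness of
  \<open>U \<times> UNIV\<close> forces openness of \<open>U\<close>.\<close>

lemma quotient_map_fst_countably_fine_product:
  "quotient_map (countably_fine_product Y) Y fst"
  unfolding quotient_map_def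
proof (intro conjI allI impI)
  fix U assume U: "U \<subseteq> topspace Y"
  have eq: "{x \<in> topspace (countably_fine_product Y). fst x \<in> U} = U \<times> UNIV"
    using U by auto
  have "openin Y U" if op: "openin (countably_fine_product Y) (U \<times> UNIV)"
  proof (subst openin_subopen, intro ballI)
    fix y assume "y \<in> U"
    then have z: "(y, 0) \<in> U \<times> UNIV" by simp
    obtain V and C :: "('a \<times> real) set" where V: "openin Y V" "y \<in> V" "countable C" "V \<times> UNIV - C \<subseteq> U \<times> UNIV"
      using bspec[OF conjunct2[OF op[unfolded openin_countably_fine_product]] z] by auto
    have "V \<subseteq> U"
    proof
      fix v assume "v \<in> V"
      moreover obtain s where "(v, s) \<notin> C"
        using uncountable_fibre_minus_countable[OF V(3)] by blast
      ultimately show "v \<in> U" using V(4) by auto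
    qed
    with V show "\<exists>T. openin Y T \<and> y \<in> T \<and> T \<subseteq> U" by blast
  qed
  then show "openin (countably_fine_product Y) {x \<in> topspace (countably_fine_product Y). fst x \<in> U}
      = openin Y U"
    unfolding eq using openin_Times_countably_fine_product by blast
qed auto

text \<open>A nonempty trace of an open set on a fibre is cocountable there, and two cocountable
  subsets of an uncountable fibre meet.\<close>

lemma connectedin_fibre_countably_fine_product:
  assumes "y \<in> topspace Y"
  shows "connectedin (countably_fine_product Y) ({y} \<times> UNIV)"
  unfolding connectedin
proof (intro conjI notI, goal_cases)
  case 2
  then obtain E1 E2 where E: "openin (countably_fine_product Y) E1"
    "openin (countably_fine_product Y) E2" "E1 \<inter> E2 \<inter> {y} \<times> UNIV = {}"
    "E1 \<inter> {y} \<times> UNIV \<noteq> {}" "E2 \<inter> {y} \<times> UNIV \<noteq> {}" by blast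
  have *: "\<exists>C. countable C \<and> {y} \<times> UNIV - C \<subseteq> E"
    if "openin (countably_fine_product Y) E" "E \<inter> {y} \<times> UNIV \<noteq> {}" for E
  proof -
    from that(2) obtain s where "(y, s) \<in> E" by auto
    with that(1)[unfolded openin_countably_fine_product]
    obtain V C where "y \<in> V" "countable C" "V \<times> UNIV - C \<subseteq> E" by (metis fst_conv)
    then show ?thesis by blast
  qed
  obtain C1 C2 where "countable C1" "{y} \<times> UNIV - C1 \<subseteq> E1" "countable C2" "{y} \<times> UNIV - C2 \<subseteq> E2"
    using * E by meson
  moreover obtain s where "(y, s) \<notin> C1 \<union> C2"
    using uncountable_fibre_minus_countable[of "C1 \<union> C2" y] calculation by auto
  ultimately show False using E(3) by blast
qed (use assms in auto)

section \<open>Recognizing a Reeb graph\<close>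

text \<open>By the universal property each quotient map factors through the other; surjectivity
  makes the two factors mutually inverse.\<close>

lemma homeomorphic_space_quotient_maps:
  assumes f: "quotient_map X Y f" and g: "quotient_map X Z g"
    and fibres: "\<And>x x'. x \<in> topspace X \<Longrightarrow> x' \<in> topspace X \<Longrightarrow> f x = f x' \<longleftrightarrow> g x = g x'"
  shows "Y homeomorphic_space Z"
proof -
  obtain h where h: "continuous_map Y Z h" "\<And>x. x \<in> topspace X \<Longrightarrow> h (f x) = g x"
    using quotient_map_lift_exists[OF f quotient_imp_continuous_map[OF g]] fibres by metis
  obtain k where k: "continuous_map Z Y k" "\<And>x. x \<in> topspace X \<Longrightarrow> k (g x) = f x"
    using quotient_map_lift_exists[OF g quotient_imp_continuous_map[OF f]] fibres by metis
  have "homeomorphic_maps Y Z h k"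
    unfolding homeomorphic_maps_def
    using h k quotient_imp_surjective_map[OF f] quotient_imp_surjective_map[OF g]
    by (metis imageE)
  then show ?thesis by (auto simp: homeomorphic_space_def)
qed

text \<open>The image of a contour under \<open>q\<close> is connected and lies in a finite level
  set of \<open>g\<close>, so it is a point: a contour stays within one fibre. Conversely, a fibre
  is connected and lies in one level set, so it stays within one contour.\<close>

lemma contour_rel_eq_fibres:
  assumes q: "quotient_map X Y q" and Y: "t1_space Y"
    and level: "\<And>y. finite {z \<in> topspace Y. g z = y}"
    and fibre: "\<And>y. y \<in> topspace Y \<Longrightarrow> connectedin X {x \<in> topspace X. q x = y}"
  shows "contour_rel X (g \<circ> q) = {(x, x') \<in> topspace X \<times> topspace X. q x = q x'}"
proof -
  have qY: "q x \<in> topspace Y" if "x \<in> topspace X" for x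
    using that quotient_imp_surjective_map[OF q] by auto
  have fibre_of: "q x = q x'" if C: "C \<in> contours X (g \<circ> q)" and x: "x \<in> C" "x' \<in> C" for C x x'
  proof -
    obtain y where y: "C \<in> connected_components_of (subtopology X {x \<in> topspace X. (g \<circ> q) x = y})"
      using C by (auto simp: mem_contours_iff)
    have "connectedin X C"
      using connectedin_connected_components_of[OF y] by (simp add: connectedin_subtopology)
    then have conn: "connectedin Y (q ` C)"
      using connectedin_continuous_map_image[OF quotient_imp_continuous_map[OF q]] by simp
    have "q ` C \<subseteq> {z \<in> topspace Y. g z = y}"
      using connected_components_of_subset[OF y] qY by auto
    then have "finite (q ` C)" using level finite_subset by blast
    then show ?thesis using t1_space_finite_connectedin[OF Y _ conn] x by blast
  qed
  have contour_of: "\<exists>C\<in>contours X (g \<circ> q). x \<in> C \<and> x' \<in> C"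
    if x: "x \<in> topspace X" "x' \<in> topspace X" "q x = q x'" for x x'
  proof -
    obtain C where C: "C \<in> contours X (g \<circ> q)" "x \<in> C"
      using Union_contours[of X "g \<circ> q"] x(1) by blast
    then obtain y where y: "C \<in> connected_components_of (subtopology X {x \<in> topspace X. (g \<circ> q) x = y})"
      by (auto simp: mem_contours_iff)
    have "g (q x) = y" using connected_components_of_subset[OF y] C by auto
    then have "connectedin (subtopology X {x \<in> topspace X. (g \<circ> q) x = y}) {z \<in> topspace X. q z = q x}"
      using fibre[OF qY[OF x(1)]] by (auto simp: connectedin_subtopology)
    from connected_components_of_maximal[OF y this] x C show ?thesis
      by (auto simp: disjnt_iff)
  qed
  have "\<Union>(contours X (g \<circ> q)) = topspace X" by (rule Union_contours)
  then have "(\<exists>C\<in>contours X (g \<circ> q). x \<in> C \<and> x' \<in> C) \<longleftrightarrow>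
      x \<in> topspace X \<and> x' \<in> topspace X \<and> q x = q x'" for x x'
    using fibre_of[of _ x x'] contour_of[of x x'] by (metis Union_iff)
  then show ?thesis
    by (simp add: contour_rel_def)
qed

lemma reeb_graph_homeomorphic_space:
  assumes "quotient_map X Y q" "t1_space Y"
    and "\<And>y. finite {z \<in> topspace Y. g z = y}"
    and "\<And>y. y \<in> topspace Y \<Longrightarrow> connectedin X {x \<in> topspace X. q x = y}"
  shows "reeb_graph X (g \<circ> q) homeomorphic_space Y"
  by (rule homeomorphic_space_quotient_maps[OF quotient_map_reeb_graph assms(1)])
    (auto simp: contour_rel_eq_fibres[OF assms])

section \<open>Changing the type of points\<close>

text \<open>Transport of structure: the topology is pulled back along the inverse of
  \<open>e\<close>. It carries a disjoint sum over to the point type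
  \<open>nat \<Rightarrow> real\<close>.\<close>

lemma homeomorphic_map_into_type:
  assumes "inj_on e (topspace X)"
  shows "\<exists>Z. homeomorphic_map X Z e"
proof
  let ?Z = "pullback_topology (e ` topspace X) (inv_into (topspace X) e) X"
  have "continuous_map X ?Z e"
    by (rule continuous_map_pullback') (use assms in \<open>auto simp: o_def intro: continuous_map_eq[OF continuous_map_id]\<close>)
  moreover have "continuous_map ?Z X (inv_into (topspace X) e)"
    using continuous_map_pullback[OF continuous_map_id[of X, unfolded id_def]] by (simp add: o_def)
  ultimately have "homeomorphic_maps X ?Z e (inv_into (topspace X) e)"
    using assms by (auto simp: homeomorphic_maps_def topspace_pullback_topology)
  then show "homeomorphic_map X ?Z e"
    by (simp add: homeomorphic_maps_map)
qed

section \<open>Betti numbers of finite disjoint sums\<close>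

text \<open>The summands embed as disjoint open subsets \<open>S i\<close>, so additivity expresses
  the homology as a direct sum and the rank counts its infinite cyclic factors. That sum is indexed
  by the subsets \<open>S i\<close>; the count is carried back to \<open>I\<close> at the
  end.\<close>

lemma betti_number_sum_topology:
  assumes Z: "Z homeomorphic_space sum_topology X I"
    and I: "finite I" and nonempty: "\<And>i. i \<in> I \<Longrightarrow> topspace (X i) \<noteq> {}"
    and cases: "\<And>i. i \<in> I \<Longrightarrow> homology_group (int p) (X i) \<cong> integer_group \<or>
      trivial_group (homology_group (int p) (X i))"
  shows "betti_number p Z = enat (card {i \<in> I. homology_group (int p) (X i) \<cong> integer_group})"
proof -
  let ?X = "sum_topology X I"
  define S where "S i = Pair i ` topspace (X i)" for i
  define A where "A T = homology_group (int p) (subtopology ?X T)" for T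
  have iso_A: "A (S i) \<cong> homology_group (int p) (X i)" if "i \<in> I" for i
  proof -
    have "X i homeomorphic_space subtopology ?X (S i)"
      using embedding_map_component_injection[OF that, of X]
      unfolding embedding_map_def S_def by (rule homeomorphic_map_imp_homeomorphic_space)
    then show ?thesis
      unfolding A_def
      by (rule homeomorphic_space_imp_isomorphic_homology_groups[OF homeomorphic_space_sym[THEN iffD1]])
  qed
  have A_Z: "A (S i) \<cong> integer_group \<longleftrightarrow> homology_group (int p) (X i) \<cong> integer_group"
    if "i \<in> I" for i
  proof -
    have "group (A (S i))" by (simp add: A_def)
    from group.iso_sym[OF this iso_A[OF that]] iso_A[OF that] show ?thesis
      by (meson iso_trans)
  qed
  \<comment> \<open>Nonemptiness matters here: all empty summands would share one image and be
    counted once.\<close>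
  have S_inj: "inj_on S I"
  proof (rule inj_onI)
    fix i j assume "i \<in> I" "S i = S j"
    moreover obtain x where "x \<in> topspace (X i)" using nonempty[OF \<open>i \<in> I\<close>] by blast
    ultimately have "(i, x) \<in> S j" unfolding S_def by blast
    then show "i = j" by (auto simp: S_def)
  qed
  have "sum_group (S ` I) A \<cong> homology_group (int p) ?X"
    unfolding A_def
  proof (rule is_isoI[OF homology_additivity_axiom])
    show "pairwise disjnt (S ` I)"
      by (auto simp: pairwise_def S_def disjnt_iff)
    show "\<Union>(S ` I) = topspace ?X"
      by (auto simp: S_def)
    show "openin ?X T" if "T \<in> S ` I" for T
      using that open_map_component_injection[of _ I X]
      unfolding S_def open_map_def by auto
  qed
  then have "homology_group (int p) ?X \<cong> sum_group (S ` I) A"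
    by (rule group.iso_sym[OF sum_group, rotated]) (simp add: A_def)
  then have "homology_group (int p) Z \<cong> sum_group (S ` I) A"
    by (rule iso_trans[OF homeomorphic_space_imp_isomorphic_homology_groups[OF Z]])
  then have "betti_number p Z = enat (card {T \<in> S ` I. A T \<cong> integer_group})"
    unfolding betti_number_def
  proof (rule abelian_rank_sum_group[OF abelian_homology_group])
    fix T assume "T \<in> S ` I"
    then obtain i where i: "i \<in> I" "T = S i" by blast
    have "trivial_group (A (S i)) \<longleftrightarrow> trivial_group (homology_group (int p) (X i))"
      by (rule isomorphic_group_triviality[OF iso_A[OF i(1)]]) (simp_all add: A_def)
    then show "A T \<cong> integer_group \<or> trivial_group (A T)"
      using cases[OF i(1)] A_Z[OF i(1)] unfolding i(2) by blast
  qed (use I in \<open>auto simp: A_def\<close>)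
  also have "{T \<in> S ` I. A T \<cong> integer_group} =
      S ` {i \<in> I. homology_group (int p) (X i) \<cong> integer_group}"
    using A_Z by auto
  also have "card \<dots> = card {i \<in> I. homology_group (int p) (X i) \<cong> integer_group}"
    using S_inj by (intro card_image) (auto intro: inj_on_subset)
  finally show ?thesis .
qed

section \<open>Quotient maps, continuity and separation for disjoint sums\<close>

lemma quotient_map_sum_topology:
  assumes "\<And>i. i \<in> I \<Longrightarrow> quotient_map (X i) (Y i) (h i)"
  shows "quotient_map (sum_topology X I) (sum_topology Y I) (\<lambda>(i, x). (i, h i x))"
  unfolding quotient_map_def
proof (intro conjI allI impI)
  have surj: "h i ` topspace (X i) = topspace (Y i)" if "i \<in> I" for i
    using assms[OF that] by (rule quotient_imp_surjective_map)
  then show "(\<lambda>(i, x). (i, h i x)) ` topspace (sum_topology X I) = topspace (sum_topology Y I)"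
    by force
  fix U assume U: "U \<subseteq> topspace (sum_topology Y I)"
  let ?P = "{z \<in> topspace (sum_topology X I). (\<lambda>(i, x). (i, h i x)) z \<in> U}"
  have "openin (X i) {x. (i, x) \<in> ?P} \<longleftrightarrow> openin (Y i) {y. (i, y) \<in> U}" if "i \<in> I" for i
  proof -
    have "{x. (i, x) \<in> ?P} = {x \<in> topspace (X i). h i x \<in> {y. (i, y) \<in> U}}"
      using that by auto
    moreover have "{y. (i, y) \<in> U} \<subseteq> topspace (Y i)" using U by auto
    ultimately show ?thesis
      using assms[OF that, unfolded quotient_map_def, THEN conjunct2, rule_format,
          of "{y. (i, y) \<in> U}"] by simp
  qed
  then show "openin (sum_topology X I) ?P = openin (sum_topology Y I) U"
    using U unfolding openin_sum_topology by auto
qed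

lemma continuous_map_sum_topology:
  assumes "\<And>i. i \<in> I \<Longrightarrow> continuous_map (X i) Y (g i)"
  shows "continuous_map (sum_topology X I) Y (\<lambda>(i, x). g i x)"
  unfolding continuous_map_def
proof (intro conjI allI impI)
  show "(\<lambda>(i, x). g i x) \<in> topspace (sum_topology X I) \<rightarrow> topspace Y"
    using assms by (fastforce simp: continuous_map_def)
  fix U assume U: "openin Y U"
  have "openin (X i) {x. (i, x) \<in> {z \<in> topspace (sum_topology X I). (\<lambda>(i, x). g i x) z \<in> U}}"
    if "i \<in> I" for i
    using openin_continuous_map_preimage[OF assms[OF that] U] that by simp
  then show "openin (sum_topology X I) {z \<in> topspace (sum_topology X I). (\<lambda>(i, x). g i x) z \<in> U}"
    unfolding openin_sum_topology by auto
qed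

lemma t1_space_sum_topology:
  assumes "\<And>i. i \<in> I \<Longrightarrow> t1_space (X i)"
  shows "t1_space (sum_topology X I)"
  unfolding t1_space_closedin_singleton
proof
  fix z assume z: "z \<in> topspace (sum_topology X I)"
  have "closedin (X i) {x. (i, x) \<in> {z}}" if "i \<in> I" for i
  proof (cases z)
    case (Pair j y)
    show ?thesis
    proof (cases "i = j")
      case True
      then have "closedin (X i) {y}"
        using z assms[OF that] Pair by (simp add: t1_space_closedin_singleton)
      then show ?thesis using Pair True by simp
    qed (simp add: Pair)
  qed
  then show "closedin (sum_topology X I) {z}"
    using z unfolding closedin_sum_topology by auto
qed

lemma quotient_map_const:
  assumes "topspace X \<noteq> {}" "topspace Y = {a}"
  shows "quotient_map X Y (\<lambda>_. a)"
  unfolding quotient_map_def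
proof (intro conjI allI impI)
  fix U assume "U \<subseteq> topspace Y"
  then consider "U = {}" | "U = topspace Y" using assms(2) by (metis subset_singletonD)
  then show "openin X {x \<in> topspace X. a \<in> U} = openin Y U"
    using assms(2) openin_topspace[of Y] by cases auto
qed (use assms in \<open>simp add: image_constant_conv\<close>)

section \<open>The circle and its height function\<close>

lemma topspace_nsphere_1_iff:
  "x \<in> topspace (nsphere 1) \<longleftrightarrow> (x 0)\<^sup>2 + (x 1)\<^sup>2 = 1 \<and> (\<forall>i>1. x i = 0)"
  by (simp add: nsphere)

text \<open>The circle is the image of the real line under the angle parametrization.\<close>

lemma connected_space_nsphere_1: "connected_space (nsphere 1)"
proof -
  define \<gamma> :: "real \<Rightarrow> nat \<Rightarrow> real"
    where "\<gamma> t = (\<lambda>n. if n = 0 then cos t else if n = 1 then sin t else 0)" for t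
  have "continuous_map euclideanreal (nsphere 1) \<gamma>"
    unfolding nsphere continuous_map_in_subtopology continuous_map_componentwise_UNIV
  proof (intro conjI allI)
    show "continuous_map euclideanreal euclideanreal (\<lambda>t. \<gamma> t n)" for n
      unfolding \<gamma>_def continuous_map_iff_continuous2
      by (cases "n = 0"; cases "n = 1") (auto intro!: continuous_intros)
  qed (auto simp: \<gamma>_def)
  moreover have "\<gamma> ` topspace euclideanreal = topspace (nsphere 1)"
  proof
    show "topspace (nsphere 1) \<subseteq> \<gamma> ` topspace euclideanreal"
    proof
      fix x assume x: "x \<in> topspace (nsphere 1)"
      then obtain t where "x 0 = cos t" "x 1 = sin t"
        unfolding topspace_nsphere_1_iff using sincos_total_2pi by metis
      then have "x = \<gamma> t"
        using x unfolding topspace_nsphere_1_iff \<gamma>_def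
        by (intro ext) (auto simp: not_less_eq linorder_neq_iff)
      then show "x \<in> \<gamma> ` topspace euclideanreal" by simp
    qed
    show "\<gamma> ` topspace euclideanreal \<subseteq> topspace (nsphere 1)"
      unfolding image_subset_iff topspace_nsphere_1_iff by (simp add: \<gamma>_def)
  qed
  ultimately show ?thesis
    using connectedin_continuous_map_image[of euclideanreal "nsphere 1" \<gamma> "topspace euclideanreal"]
    by (simp add: connectedin_topspace)
qed

text \<open>Fixing the coordinate \<open>x 0\<close> leaves at most two values for
  \<open>x 1\<close>, and all further coordinates vanish.\<close>

lemma finite_level_nsphere_1: "finite {x \<in> topspace (nsphere 1). x 0 = c}"
proof -
  define p :: "real \<Rightarrow> nat \<Rightarrow> real"
    where "p s = (\<lambda>n. if n = 0 then c else if n = 1 then s else 0)" for s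
  have "{x \<in> topspace (nsphere 1). x 0 = c} \<subseteq> p ` {sqrt (1 - c\<^sup>2), - sqrt (1 - c\<^sup>2)}"
  proof
    fix x assume "x \<in> {x \<in> topspace (nsphere 1). x 0 = c}"
    then have x: "c\<^sup>2 + (x 1)\<^sup>2 = 1" "\<forall>i>1. x i = 0" "x 0 = c"
      unfolding topspace_nsphere_1_iff by auto
    have "\<bar>x 1\<bar> = sqrt (1 - c\<^sup>2)"
      using x(1) by (intro real_sqrt_unique[symmetric]) auto
    then have "x 1 \<in> {sqrt (1 - c\<^sup>2), - sqrt (1 - c\<^sup>2)}" by auto
    moreover have "x = p (x 1)"
      using x unfolding p_def by (intro ext) (auto simp: linorder_neq_iff)
    ultimately show "x \<in> p ` {sqrt (1 - c\<^sup>2), - sqrt (1 - c\<^sup>2)}" by blast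
  qed
  then show ?thesis using finite_subset by blast
qed

lemma homology_group_nsphere_1: "homology_group 1 (nsphere 1) \<cong> integer_group"
  using reduced_homology_group_nsphere(1)[of 1]
  by (subst (asm) un_reduced_homology_group) simp_all

section \<open>The construction\<close>

theorem proposition3p2:
  fixes r b :: nat
  shows "\<exists>(X :: (nat \<Rightarrow> real) topology) (f :: (nat \<Rightarrow> real) \<Rightarrow> real).
           continuous_map X euclideanreal f \<and>
           cycle_rank (reeb_graph X f) = enat r \<and>
           betti_number 1 X = enat b"
proof -
  define a :: "nat \<Rightarrow> real" where "a = (\<lambda>n. if n = 0 then 1 else 0)"
  have a: "a \<in> topspace (nsphere 1)"
    unfolding a_def by (rule in_topspace_nsphere)
  define I where "I = {..<r + b}"
  \<comment> \<open>The summands of a disjoint sum share one point type, so an ordinary circle is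
    multiplied by a one-point space.\<close>
  define X where "X i = (if i < r then countably_fine_product (nsphere 1)
    else prod_topology (nsphere 1) (discrete_topology {0 :: real}))" for i
  \<comment> \<open>The components of the intended Reeb graph: \<open>r\<close> circles, whose
    cycles are invisible in \<open>X\<close>, and \<open>b\<close> points, to which the ordinary
    circles collapse.\<close>
  define Y where "Y i = (if i < r then nsphere 1 else subtopology (nsphere 1) {a})" for i
  define h :: "nat \<Rightarrow> (nat \<Rightarrow> real) \<times> real \<Rightarrow> nat \<Rightarrow> real"
    where "h i = (if i < r then fst else (\<lambda>_. a))" for i
  define q where "q = (\<lambda>(i, z). (i, h i z))"
  \<comment> \<open>The height function is the same on all summands. Level sets of \<open>g\<close>
    stay finite because \<open>I\<close> is finite, and this already suffices to separate the
    contours of different summands.\<close>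
  define g :: "nat \<times> (nat \<Rightarrow> real) \<Rightarrow> real" where "g = (\<lambda>(i, x). x 0)"
  let ?X = "sum_topology X I" and ?Y = "sum_topology Y I"
  have "quotient_map (X i) (Y i) (h i)" for i
    using a by (auto simp: X_def Y_def h_def intro!: quotient_map_fst_countably_fine_product quotient_map_const)
  then have q: "quotient_map ?X ?Y q"
    unfolding q_def by (intro quotient_map_sum_topology)
  have t1: "t1_space ?Y"
  proof (rule t1_space_sum_topology)
    have "t1_space (nsphere 1)"
      unfolding nsphere_def
      by (intro t1_space_subtopology Hausdorff_imp_t1_space Hausdorff_Euclidean_space)
    then show "t1_space (Y i)" for i
      by (simp add: Y_def t1_space_subtopology)
  qed
  have level: "finite {z \<in> topspace ?Y. g z = c}" for c
  proof (rule finite_subset)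
    show "{z \<in> topspace ?Y. g z = c} \<subseteq> I \<times> {x \<in> topspace (nsphere 1). x 0 = c}"
    proof
      fix z assume "z \<in> {z \<in> topspace ?Y. g z = c}"
      moreover obtain i x where z: "z = (i, x)" by (cases z)
      ultimately have "i \<in> I" "x \<in> topspace (Y i)" "x 0 = c" by (auto simp: g_def)
      then show "z \<in> I \<times> {x \<in> topspace (nsphere 1). x 0 = c}"
        unfolding z by (auto simp: Y_def split: if_splits)
    qed
    show "finite (I \<times> {x \<in> topspace (nsphere 1). x 0 = c})"
      by (intro finite_cartesian_product finite_level_nsphere_1) (simp add: I_def)
  qed
  \<comment> \<open>A fibre of \<open>q\<close> lies in a single summand, where it is either a fibre
    of the projection or a whole circle.\<close>
  have fibre: "connectedin ?X {z \<in> topspace ?X. q z = y}" if "y \<in> topspace ?Y" for y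
  proof -
    obtain i v where y: "y = (i, v)" by (cases y)
    with that have i: "i \<in> I" "v \<in> topspace (Y i)" by auto
    have "connectedin (X i) {z \<in> topspace (X i). h i z = v}"
    proof (cases "i < r")
      case True
      then have "{z \<in> topspace (X i). h i z = v} = {v} \<times> UNIV"
        using i by (auto simp: X_def Y_def h_def)
      then show ?thesis
        using True i connectedin_fibre_countably_fine_product[of v "nsphere 1"]
        by (simp add: X_def Y_def)
    next
      case False
      then have "{z \<in> topspace (X i). h i z = v} = topspace (X i)"
        using i by (auto simp: X_def Y_def h_def)
      moreover have "connected_space (X i)"
        using False connected_space_nsphere_1 by (simp add: X_def connected_space_prod_topology connected_space_discrete_topology)
      ultimately show ?thesis by (simp add: connectedin_topspace)
    qed
    then have "connectedin ?X (Pair i ` {z \<in> topspace (X i). h i z = v})"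
      using connectedin_continuous_map_image[OF continuous_map_component_injection[OF i(1)]] by blast
    moreover have "{z \<in> topspace ?X. q z = y} = Pair i ` {z \<in> topspace (X i). h i z = v}"
      using i by (auto simp: q_def y)
    ultimately show ?thesis by simp
  qed
  have g: "continuous_map ?Y euclideanreal g"
    unfolding g_def Y_def
    by (rule continuous_map_sum_topology)
      (auto intro: continuous_map_nsphere_projection continuous_map_from_subtopology)

  \<comment> \<open>The sum is encoded in sequences: the index \<open>i\<close> at place 0, the real
    coordinate \<open>s\<close> at place 1, and \<open>x\<close> shifted by two places.\<close>
  define e :: "nat \<times> (nat \<Rightarrow> real) \<times> real \<Rightarrow> nat \<Rightarrow> real"
    where "e = (\<lambda>(i, x, s). case_nat (real i) (case_nat s x))"
  have "inj e"
  proof (rule injI)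
    fix z w assume e: "e z = e w"
    obtain i x s j y t where zw: "z = (i, x, s)" "w = (j, y, t)" by (cases z; cases w)
    have eq: "e (i, x, s) n = e (j, y, t) n" for n using e zw by simp
    have "x n = y n" for n using eq[of "Suc (Suc n)"] by (simp add: e_def)
    moreover have "i = j" "s = t" using eq[of 0] eq[of "Suc 0"] by (simp_all add: e_def)
    ultimately show "z = w" unfolding zw by auto
  qed
  then obtain Z where Z: "homeomorphic_map ?X Z e"
    using homeomorphic_map_into_type inj_on_subset by blast
  then obtain e' where e': "homeomorphic_maps ?X Z e e'"
    by (auto simp: homeomorphic_map_maps)
  have ZX: "Z homeomorphic_space ?X"
    using Z homeomorphic_map_imp_homeomorphic_space homeomorphic_space_sym by blast
  have e'_hom: "homeomorphic_map Z ?X e'"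
    using e' homeomorphic_maps_map by blast
  \<comment> \<open>Only the source is moved to the new point type; the target \<open>?Y\<close> of
    the quotient map stays, so the conditions on \<open>g\<close> carry over unchanged.\<close>
  have qZ: "quotient_map Z ?Y (q \<circ> e')"
    using quotient_map_compose[OF e'_hom[unfolded homeomorphic_map_def, THEN conjunct1] q] .
  have fibreZ: "connectedin Z {x \<in> topspace Z. (q \<circ> e') x = y}" if "y \<in> topspace ?Y" for y
  proof -
    have "connectedin Z (e ` {z \<in> topspace ?X. q z = y})"
      using connectedin_continuous_map_image[OF homeomorphic_imp_continuous_map[OF Z] fibre[OF that]] .
    moreover have "e ` {z \<in> topspace ?X. q z = y} = {x \<in> topspace Z. (q \<circ> e') x = y}"
    proof -
      have 1: "e ` topspace ?X = topspace Z"
        using Z by (rule homeomorphic_imp_surjective_map)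
      have 2: "e' (e z) = z" if "z \<in> topspace ?X" for z
        using e' that unfolding homeomorphic_maps_def by blast
      show ?thesis
        unfolding 1[symmetric] using 2 by (auto simp del: topspace_sum_topology)
    qed
    ultimately show ?thesis by simp
  qed
  have Reeb: "reeb_graph Z (g \<circ> (q \<circ> e')) homeomorphic_space ?Y"
    using qZ t1 level fibreZ by (rule reeb_graph_homeomorphic_space)

  \<comment> \<open>As the integers are not a trivial group, the two possibilities exclude each
    other; the second claim then settles the case \<open>i < r\<close> of the first.\<close>
  have X_homology: "homology_group 1 (X i) \<cong> integer_group \<longleftrightarrow> \<not> i < r"
    "\<not> i < r \<or> trivial_group (homology_group 1 (X i))" for i
  proof -
    show "\<not> i < r \<or> trivial_group (homology_group 1 (X i))"
      by (auto simp: X_def intro!: trivial_homology_group_countable_closed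
          closedin_countable_countably_fine_product)
    then show "homology_group 1 (X i) \<cong> integer_group \<longleftrightarrow> \<not> i < r"
      using isomorphic_group_triviality[of "homology_group 1 (X i)" integer_group]
        iso_trans[OF homeomorphic_space_imp_isomorphic_homology_groups[OF
            prod_topology_homeomorphic_space_left[OF refl]] homology_group_nsphere_1]
      by (auto simp: X_def)
  qed
  have Y_homology: "homology_group 1 (Y i) \<cong> integer_group \<longleftrightarrow> i < r"
    "i < r \<or> trivial_group (homology_group 1 (Y i))" for i
  proof -
    show "i < r \<or> trivial_group (homology_group 1 (Y i))"
      using a by (auto simp: Y_def intro!: homology_dimension_axiom)
    then show "homology_group 1 (Y i) \<cong> integer_group \<longleftrightarrow> i < r"
      using isomorphic_group_triviality[of "homology_group 1 (Y i)" integer_group]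
        homology_group_nsphere_1
      by (auto simp: Y_def)
  qed
  have "betti_number 1 Z = enat (card {i \<in> I. homology_group (int 1) (X i) \<cong> integer_group})"
  proof (rule betti_number_sum_topology[OF ZX])
    have "(a, 0) \<in> topspace (X i)" for i using a by (simp add: X_def)
    then show "topspace (X i) \<noteq> {}" for i by blast
  qed (use X_homology in \<open>auto simp: I_def\<close>)
  \<comment> \<open>In \<open>Z\<close> exactly the \<open>b\<close> ordinary circles contribute; in
    the Reeb graph it will be exactly the other \<open>r\<close> indices.\<close>
  also have "{i \<in> I. homology_group (int 1) (X i) \<cong> integer_group} = {r..<r + b}"
    by (auto simp: I_def X_homology(1))
  finally have bX: "betti_number 1 Z = enat b" by simp
  have "betti_number 1 (reeb_graph Z (g \<circ> (q \<circ> e'))) =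
      enat (card {i \<in> I. homology_group (int 1) (Y i) \<cong> integer_group})"
  proof (rule betti_number_sum_topology[OF Reeb])
    have "a \<in> topspace (Y i)" for i using a by (simp add: Y_def)
    then show "topspace (Y i) \<noteq> {}" for i by blast
  qed (use Y_homology in \<open>auto simp: I_def\<close>)
  also have "{i \<in> I. homology_group (int 1) (Y i) \<cong> integer_group} = {..<r}"
    by (auto simp: I_def Y_homology(1))
  finally have bY: "cycle_rank (reeb_graph Z (g \<circ> (q \<circ> e'))) = enat r"
    by (simp only: cycle_rank_def card_lessThan)
  have "continuous_map Z euclideanreal (g \<circ> (q \<circ> e'))"
    using continuous_map_compose[OF quotient_imp_continuous_map[OF qZ] g] .
  with bX bY show ?thesis by blast
qed

end
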